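(* Let $P$ be a finite totally ordered poset and let $S\colon P\to\mathsf{Set}$ be a persistent set. Suppose that $S$ has at least two generators and that $S_\top$ is a singleton, where $\top$ is the maximum element of $P$. Then every maximal generator of $S$ (with respect to the preorder on generators) is a rooted generator.
   Context: A persistent set over a finite poset $P$ (viewed as a category) is a functor $S\colon P\to\mathsf{Set}$ to finite sets, with maps $S_{p\to q}\colon S_p\to S_q$ for $p\le q$; morphisms are natural transformations. An endomorphism $\varphi$ is idempotent if $\varphi\circ\varphi=\varphi$. A generator of $S$ is a pair $(p_x,x)$ with $x\in S_{p_x}$ such that $x$ is not in the image of $S_{q\to p_x}$ for any $q<p_x$. The generators are preordered by $(p_x,x)\le(p_y,y)$ iff $p_x\le p_y$; a generator is maximal if every generator above it in this preorder is also below it. A generator $(p_x,x)$ is fixed by an endomorphism $\varphi$ of $S$ if $\varphi_{p_x}(x)=x$. A generator $x$ is a rooted generator if there exists an idempotent endomorphism $\varphi$ of $S$ such that $x$ is the only generator of $S$ that is not fixed by $\varphi$. *)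

theory Defs
  imports Main "HOL-Library.FuncSet"
begin

text \<open>
  A poset is a type of class \<open>order\<close>. All fibres of a persistent set live in one
  ambient type \<open>'a\<close>; they need not be disjoint. The structure maps and the components of
  morphisms are HOL functions that matter only on the fibres (and, for structure maps, only
  for \<open>p \<le> q\<close>), so every equation between them is required only there.
\<close>

record ('p, 'a) persistent_data =
  fib :: "'p \<Rightarrow> 'a set"
  trans_map :: "'p \<Rightarrow> 'p \<Rightarrow> 'a \<Rightarrow> 'a"

definition persistent_set :: "('p::order, 'a) persistent_data \<Rightarrow> bool" where
  "persistent_set S \<longleftrightarrow>
     (\<forall>p. finite (fib S p)) \<and>
     (\<forall>p q. p \<le> q \<longrightarrow> trans_map S p q \<in> fib S p \<rightarrow> fib S q) \<and>
     (\<forall>p. \<forall>x\<in>fib S p. trans_map S p p x = x) \<and>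
     (\<forall>p q r. p \<le> q \<longrightarrow> q \<le> r \<longrightarrow>
        (\<forall>x\<in>fib S p. trans_map S q r (trans_map S p q x) = trans_map S p r x))"

definition morphism ::
  "('p::order, 'a) persistent_data \<Rightarrow> ('p, 'b) persistent_data \<Rightarrow> ('p \<Rightarrow> 'a \<Rightarrow> 'b) \<Rightarrow> bool" where
  "morphism S T f \<longleftrightarrow>
     (\<forall>p. f p \<in> fib S p \<rightarrow> fib T p) \<and>
     (\<forall>p q. p \<le> q \<longrightarrow>
        (\<forall>x\<in>fib S p. f q (trans_map S p q x) = trans_map T p q (f p x)))"

definition idempotent_endo ::
  "('p::order, 'a) persistent_data \<Rightarrow> ('p \<Rightarrow> 'a \<Rightarrow> 'a) \<Rightarrow> bool" where
  "idempotent_endo S f \<longleftrightarrow> morphism S S f \<and> (\<forall>p. \<forall>x\<in>fib S p. f p (f p x) = f p x)"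

definition generators :: "('p::order, 'a) persistent_data \<Rightarrow> ('p \<times> 'a) set" where
  "generators S = {(p, x). x \<in> fib S p \<and> (\<forall>q<p. x \<notin> trans_map S q p ` fib S q)}"

definition gen_le :: "('p::order \<times> 'a) \<Rightarrow> ('p \<times> 'a) \<Rightarrow> bool" where
  "gen_le g h \<longleftrightarrow> fst g \<le> fst h"

definition maximal_generator :: "('p::order, 'a) persistent_data \<Rightarrow> 'p \<times> 'a \<Rightarrow> bool" where
  "maximal_generator S g \<longleftrightarrow>
     g \<in> generators S \<and> (\<forall>h\<in>generators S. gen_le g h \<longrightarrow> gen_le h g)"

definition fixed_by :: "('p \<Rightarrow> 'a \<Rightarrow> 'a) \<Rightarrow> 'p \<times> 'a \<Rightarrow> bool" where
  "fixed_by f g \<longleftrightarrow> f (fst g) (snd g) = snd g"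

definition rooted_generator :: "('p::order, 'a) persistent_data \<Rightarrow> 'p \<times> 'a \<Rightarrow> bool" where
  "rooted_generator S g \<longleftrightarrow>
     (\<exists>f. idempotent_endo S f \<and> {h \<in> generators S. \<not> fixed_by f h} = {g})"

end

theory Submission
  imports Defs
begin

text \<open>
  Let \<open>(p, x)\<close> be a maximal generator. Over a chain, maximality means that nothing is born after
  \<open>p\<close>, so every element living at some \<open>q \<ge> p\<close> is the image of an element of the fibre at \<open>p\<close>
  (\<open>lift_to_fibre_of_maximal_generator\<close>). A second generator leaves an element other than \<open>x\<close> in
  that fibre: it is either born at \<open>p\<close> itself, or born earlier and then its image at \<open>p\<close> is not
  \<open>x\<close>, because \<open>x\<close> is not an image.

  Since the top fibre is a singleton, \<open>x\<close> merges with each of these other elements sooner or later.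
  Choose \<open>y\<close> among those that merge with \<open>x\<close> first (\<open>exists_first_merging\<close>). The map that moves
  the trajectory of \<open>x\<close> onto the trajectory of \<open>y\<close> and fixes everything else is then an idempotent
  endomorphism. The only threat to naturality is an element off the trajectory of \<open>x\<close> that runs into
  it later; but by the choice of \<open>y\<close> the trajectories of \<open>x\<close> and \<open>y\<close> agree from that degree on, so
  nothing is moved there (\<open>idempotent_redirect\<close>). The only generator on the trajectory of \<open>x\<close> is
  \<open>(p, x)\<close> itself, and it is moved.
\<close>

lemma persistent_set_closed:
  assumes "persistent_set S" "p \<le> q" "x \<in> fib S p"
  shows "trans_map S p q x \<in> fib S q"
  using assms unfolding persistent_set_def by blast

lemma persistent_set_id:
  assumes "persistent_set S" "x \<in> fib S p"
  shows "trans_map S p p x = x"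
  using assms unfolding persistent_set_def by blast

lemma persistent_set_comp:
  assumes "persistent_set S" "p \<le> q" "q \<le> r" "x \<in> fib S p"
  shows "trans_map S q r (trans_map S p q x) = trans_map S p r x"
  using assms unfolding persistent_set_def by blast

text \<open>Trace an element back to a minimal degree at which it has a preimage: by minimality that
  preimage is itself in no earlier image.\<close>

lemma exists_generator_over:
  fixes S :: "('p::{finite,order}, 'a) persistent_data"
  assumes S: "persistent_set S" and z: "z \<in> fib S q"
  shows "\<exists>p w. (p, w) \<in> generators S \<and> p \<le> q \<and> trans_map S p q w = z"
proof -
  define B where "B = {p. p \<le> q \<and> z \<in> trans_map S p q ` fib S p}"
  have "z \<in> trans_map S q q ` fib S q"
    using persistent_set_id[OF S z] z by force
  then have "q \<in> B" by (simp add: B_def)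
  then obtain p where p: "p \<in> B" and min: "\<And>r. r \<in> B \<Longrightarrow> r \<le> p \<Longrightarrow> p = r"
    using finite_has_minimal[of B] by (metis empty_iff finite)
  from p obtain w where pq: "p \<le> q" and w: "w \<in> fib S p" "trans_map S p q w = z"
    unfolding B_def by blast
  have "w \<notin> trans_map S r p ` fib S r" if "r < p" for r
  proof
    assume "w \<in> trans_map S r p ` fib S r"
    then obtain v where v: "v \<in> fib S r" "w = trans_map S r p v" by blast
    then have "trans_map S r q v = z"
      using persistent_set_comp[OF S _ pq] w that by fastforce
    then have "r \<in> B"
      using v that pq unfolding B_def by force
    then show False using min that by fastforce
  qed
  then have "(p, w) \<in> generators S" using w by (simp add: generators_def)
  then show ?thesis using pq w by blast
qed

lemma maximal_generator_degree:
  fixes S :: "('p::linorder, 'a) persistent_data"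
  assumes "maximal_generator S (p, x)" "(q, z) \<in> generators S"
  shows "q \<le> p"
  using assms unfolding maximal_generator_def gen_le_def by fastforce

lemma lift_to_fibre_of_maximal_generator:
  fixes S :: "('p::{finite,linorder}, 'a) persistent_data"
  assumes S: "persistent_set S" and g: "maximal_generator S (p, x)"
    and "p \<le> q" and z: "z \<in> fib S q"
  shows "\<exists>w\<in>fib S p. trans_map S p q w = z"
proof -
  obtain r v where v: "(r, v) \<in> generators S" "trans_map S r q v = z"
    using exists_generator_over[OF S z] by blast
  have "r \<le> p" using maximal_generator_degree[OF g v(1)] .
  moreover have "v \<in> fib S r" using v(1) by (simp add: generators_def)
  ultimately show ?thesis
    using v(2) persistent_set_comp[OF S _ \<open>p \<le> q\<close>] persistent_set_closed[OF S] by metis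
qed

lemma exists_other_element:
  fixes S :: "('p::linorder, 'a) persistent_data"
  assumes S: "persistent_set S" and g: "maximal_generator S (p, x)"
    and two: "card (generators S) \<ge> 2"
  shows "\<exists>y\<in>fib S p. y \<noteq> x"
proof -
  have "\<not> generators S \<subseteq> {(p, x)}"
    using two card_mono[of "{(p, x)}" "generators S"] by auto
  then obtain q z where z: "(q, z) \<in> generators S" "(q, z) \<noteq> (p, x)" by force
  have zq: "z \<in> fib S q" using z by (simp add: generators_def)
  have "q \<le> p" using maximal_generator_degree[OF g z(1)] .
  then consider "q = p" | "q < p" by force
  then show ?thesis
  proof cases
    case 1
    then show ?thesis using z zq by blast
  next
    case 2
    have "trans_map S q p z \<noteq> x"
      using g 2 zq unfolding maximal_generator_def generators_def by auto
    then show ?thesis using persistent_set_closed[OF S \<open>q \<le> p\<close> zq] by blast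
  qed
qed

text \<open>Once two trajectories agree they agree for good, so it suffices to let \<open>y\<close> realise the least
  degree at which any element merges with \<open>x\<close>; the singleton top fibre ensures that there is
  such a degree.\<close>

lemma exists_first_merging:
  fixes S :: "('p::{finite,linorder}, 'a) persistent_data"
  assumes S: "persistent_set S" and top: "is_singleton (fib S (Max UNIV))"
    and x: "x \<in> fib S p" and other: "\<exists>y\<in>fib S p. y \<noteq> x"
  obtains y where "y \<in> fib S p" "y \<noteq> x"
    "\<And>z q. \<lbrakk>z \<in> fib S p; z \<noteq> x; p \<le> q; trans_map S p q z = trans_map S p q x\<rbrakk>
      \<Longrightarrow> trans_map S p q y = trans_map S p q x"
proof -
  define M where
    "M = {q. p \<le> q \<and> (\<exists>y\<in>fib S p. y \<noteq> x \<and> trans_map S p q y = trans_map S p q x)}"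
  have le_top: "p \<le> Max UNIV" by simp
  obtain t where "fib S (Max UNIV) = {t}" using top is_singletonE by blast
  then have "trans_map S p (Max UNIV) z = t" if "z \<in> fib S p" for z
    using persistent_set_closed[OF S le_top that] by simp
  then have "Max UNIV \<in> M" using other x le_top unfolding M_def by auto
  then have "Min M \<in> M" by (metis Min_in empty_iff finite)
  then obtain y where y: "y \<in> fib S p" "y \<noteq> x" "p \<le> Min M"
    "trans_map S p (Min M) y = trans_map S p (Min M) x"
    unfolding M_def by blast
  have "trans_map S p q y = trans_map S p q x"
    if "z \<in> fib S p" "z \<noteq> x" "p \<le> q" "trans_map S p q z = trans_map S p q x" for z q
  proof -
    have "q \<in> M" using that unfolding M_def by blast
    then have "Min M \<le> q" by simp
    then show ?thesis using persistent_set_comp[OF S y(3)] y x by metis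
  qed
  then show ?thesis using that y by blast
qed

definition redirect ::
  "('p::order, 'a) persistent_data \<Rightarrow> 'p \<Rightarrow> 'a \<Rightarrow> 'a \<Rightarrow> 'p \<Rightarrow> 'a \<Rightarrow> 'a" where
  "redirect S p x y q z = (if p \<le> q \<and> z = trans_map S p q x then trans_map S p q y else z)"

text \<open>Naturality along \<open>q \<le> r\<close> is immediate on the trajectory of \<open>x\<close>. Any other element \<open>z\<close> has,
  at degree \<open>r \<ge> p\<close>, the same image as some \<open>w \<noteq> x\<close> in the fibre at \<open>p\<close>: if \<open>q \<ge> p\<close> then \<open>w\<close> is a
  preimage of \<open>z\<close>, and if \<open>q < p\<close> then \<open>w\<close> is the image of \<open>z\<close>, which is not \<open>x\<close> because \<open>x\<close> is a
  generator. If that image lies on the trajectory of \<open>x\<close>, so does the image of \<open>y\<close>.\<close>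

lemma idempotent_redirect:
  fixes S :: "('p::linorder, 'a) persistent_data"
  assumes S: "persistent_set S" and g: "(p, x) \<in> generators S" and y: "y \<in> fib S p"
    and lift: "\<And>q z. \<lbrakk>p \<le> q; z \<in> fib S q\<rbrakk> \<Longrightarrow> \<exists>w\<in>fib S p. trans_map S p q w = z"
    and merge: "\<And>z q. \<lbrakk>z \<in> fib S p; z \<noteq> x; p \<le> q; trans_map S p q z = trans_map S p q x\<rbrakk>
      \<Longrightarrow> trans_map S p q y = trans_map S p q x"
  shows "idempotent_endo S (redirect S p x y)"
proof -
  let ?f = "redirect S p x y"
  have x: "x \<in> fib S p" and born: "\<And>q. q < p \<Longrightarrow> x \<notin> trans_map S q p ` fib S q"
    using g by (auto simp: generators_def)
  have closed: "?f q z \<in> fib S q" if "z \<in> fib S q" for q z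
    using that persistent_set_closed[OF S _ y] by (simp add: redirect_def)
  have natural: "?f r (trans_map S q r z) = trans_map S q r (?f q z)"
    if qr: "q \<le> r" and z: "z \<in> fib S q" for q r z
  proof (cases "p \<le> q \<and> z = trans_map S p q x")
    case True
    then show ?thesis
      using persistent_set_comp[OF S _ qr] x y qr by (auto simp: redirect_def)
  next
    case off: False
    have "trans_map S p r y = trans_map S p r x"
      if pr: "p \<le> r" and hit: "trans_map S q r z = trans_map S p r x"
    proof -
      have "\<exists>w\<in>fib S p. w \<noteq> x \<and> trans_map S p r w = trans_map S q r z"
      proof (cases "p \<le> q")
        case True
        then obtain w where w: "w \<in> fib S p" "trans_map S p q w = z" using lift z by blast
        then show ?thesis using persistent_set_comp[OF S True qr] off True by metis
      next
        case False
        then have "q < p" by simp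
        then have "trans_map S q p z \<in> fib S p" "trans_map S q p z \<noteq> x"
          using persistent_set_closed[OF S _ z] born z by auto
        then show ?thesis using persistent_set_comp[OF S _ pr z] \<open>q < p\<close> by fastforce
      qed
      then show ?thesis using merge pr hit by metis
    qed
    then show ?thesis using off by (auto simp: redirect_def)
  qed
  have "?f q (?f q z) = ?f q z" for q z by (simp add: redirect_def)
  then show ?thesis
    using closed natural unfolding idempotent_endo_def morphism_def by blast
qed

theorem proposition4p1:
  fixes S :: "('p::{finite,linorder}, 'a) persistent_data"
  assumes "persistent_set S"
    and "card (generators S) \<ge> 2"
    and "is_singleton (fib S (Max UNIV))"
  shows "\<forall>g. maximal_generator S g \<longrightarrow> rooted_generator S g"
proof (intro allI impI)
  note S = assms(1)
  fix g assume g: "maximal_generator S g"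
  obtain p x where gpx: "g = (p, x)" by (cases g)
  have max: "maximal_generator S (p, x)" using g gpx by simp
  then have gen: "(p, x) \<in> generators S" by (simp add: maximal_generator_def)
  then have x: "x \<in> fib S p" by (simp add: generators_def)
  obtain y where y: "y \<in> fib S p" "y \<noteq> x"
    and merge: "\<And>z q. \<lbrakk>z \<in> fib S p; z \<noteq> x; p \<le> q; trans_map S p q z = trans_map S p q x\<rbrakk>
      \<Longrightarrow> trans_map S p q y = trans_map S p q x"
    using exists_first_merging[OF S assms(3) x exists_other_element[OF S max assms(2)]] by metis
  have idem: "idempotent_endo S (redirect S p x y)"
    using idempotent_redirect[OF S gen y(1) lift_to_fibre_of_maximal_generator[OF S max] merge] .
  have "fixed_by (redirect S p x y) h \<longleftrightarrow> h \<noteq> (p, x)" if "h \<in> generators S" for h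
  proof -
    obtain q z where h: "h = (q, z)" by (cases h)
    have "q \<le> p" using maximal_generator_degree[OF max] that h by simp
    then have "p \<le> q \<longleftrightarrow> q = p" by auto
    then show ?thesis
      using persistent_set_id[OF S] x y h by (auto simp: fixed_by_def redirect_def)
  qed
  then have "{h \<in> generators S. \<not> fixed_by (redirect S p x y) h} = {(p, x)}"
    using gen by blast
  then show "rooted_generator S g"
    using idem gpx unfolding rooted_generator_def by blast
qed

end
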